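(* Let $V=\coprod_{n\ge t}V_{(n)}$ (with $t\in\mathbb{Z}$) be any lower truncated $\mathbb{Z}$-graded vertex algebra, such as a vertex operator algebra. Then for any graded subspace $U$ of $V$, $V=U+C_2(V)$ if and only if $V$ is linearly spanned by the vectors $$u^{(1)}_{-n_1}\cdots u^{(r)}_{-n_r}\mathbf{1}$$ for $r\ge 0$, $n_1>\cdots>n_r\ge 1$, $u^{(1)},\dots,u^{(r)}\in U$.
   Context: Vector spaces are over $\mathbb{C}$. For a vertex algebra $V$ with vacuum $\mathbf{1}$ write $Y(u,x)=\sum_{n\in\mathbb{Z}}u_nx^{-n-1}$. A $\mathbb{Z}$-graded vertex algebra is a vertex algebra with a grading $V=\coprod_{n\in\mathbb{Z}}V_{(n)}$ such that $\mathbf{1}\in V_{(0)}$ and $u_mV_{(n)}\subset V_{(n+k-m-1)}$ for $u\in V_{(k)}$, $k,m,n\in\mathbb{Z}$. It is lower truncated if $V_{(n)}=0$ for $n$ sufficiently small; $V=\coprod_{n\ge t}V_{(n)}$ means $V_{(n)}=0$ for $n<t$. Vertex operator algebras are meant in the sense of Frenkel–Lepowsky–Meurman and Frenkel–Huang–Lepowsky. A subspace $U$ is graded if $U=\coprod_n (U\cap V_{(n)})$. $C_2(V)$ is the linear span of the vectors $u_{-2}v$ for $u,v\in V$.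
   Formalization: The "if" direction is proved under the added condition that 1 lies in U + C_2(V); without it the claim fails, e.g. V = ℂ, U = 0, where the r = 0 vector 1 spans V but U + C_2(V) = 0. The "only if" direction is as stated. *)

theory Defs
  imports Complex_Main "HOL-Library.Groups_Big_Fun" "HOL-Library.Set_Algebras"
begin

text \<open>
  \<^term>\<open>nprod u n v\<close> stands for \<open>u\<^sub>n v\<close>, where \<open>Y(u,x) = \<Sum>n. u\<^sub>n x^(-n-1)\<close>.
  The axiom \<open>jacobi\<close> is the coefficient of \<open>x0^(-l-1) x1^(-m-1) x2^(-n-1)\<close> in the Jacobi identity
  (the Borcherds identity). By \<open>truncation\<close> its three sums have finite support, so that
  \<^const>\<open>Sum_any\<close>, which is \<open>0\<close> on functions of infinite support, gives their actual values.
\<close>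

locale vertex_algebra = vector_space scale
  for scale :: "complex \<Rightarrow> 'v::ab_group_add \<Rightarrow> 'v" +
  fixes vac :: 'v
    and nprod :: "'v \<Rightarrow> int \<Rightarrow> 'v \<Rightarrow> 'v"
  assumes linear_left: "Vector_Spaces.linear scale scale (\<lambda>u. nprod u n v)"
    and linear_right: "Vector_Spaces.linear scale scale (\<lambda>v. nprod u n v)"
    and truncation: "\<exists>N. \<forall>n\<ge>N. nprod u n v = 0"
    and vacuum: "nprod vac n v = (if n = -1 then v else 0)"
    and creation: "n \<ge> 0 \<Longrightarrow> nprod u n vac = 0" "nprod u (-1) vac = u"
    and jacobi:
      "Sum_any (\<lambda>i::nat. scale ((-1) ^ i * (of_int l gchoose i))
           (nprod u (m + l - int i) (nprod v (n + int i) w)))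
       - Sum_any (\<lambda>i::nat. scale ((-1) powi l * (-1) ^ i * (of_int l gchoose i))
           (nprod v (n + l - int i) (nprod u (m + int i) w)))
       = Sum_any (\<lambda>i::nat. scale (of_int m gchoose i)
           (nprod (nprod u (l + int i) v) (m + n - int i) w))"

text \<open>
  The summation map from the external direct sum of the subspaces \<open>W n\<close> is a bijection onto \<open>A\<close>.
\<close>

definition is_direct_sum ::
  "(complex \<Rightarrow> 'v::ab_group_add \<Rightarrow> 'v) \<Rightarrow> 'v set \<Rightarrow> (int \<Rightarrow> 'v set) \<Rightarrow> bool" where
  "is_direct_sum scale A W \<longleftrightarrow>
     (\<forall>n. module.subspace scale (W n)) \<and>
     bij_betw Sum_any {f. (\<forall>n. f n \<in> W n) \<and> finite {n. f n \<noteq> 0}} A"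

locale graded_vertex_algebra = vertex_algebra scale vac nprod
  for scale :: "complex \<Rightarrow> 'v::ab_group_add \<Rightarrow> 'v" and vac nprod +
  fixes grade :: "int \<Rightarrow> 'v set"
  assumes grading: "is_direct_sum scale UNIV grade"
    and vac_grade: "vac \<in> grade 0"
    and nprod_grade: "u \<in> grade k \<Longrightarrow> v \<in> grade n \<Longrightarrow> nprod u m v \<in> grade (n + k - m - 1)"

definition graded_subspace ::
  "(complex \<Rightarrow> 'v::ab_group_add \<Rightarrow> 'v) \<Rightarrow> (int \<Rightarrow> 'v set) \<Rightarrow> 'v set \<Rightarrow> bool" where
  "graded_subspace scale grade U \<longleftrightarrow>
     module.subspace scale U \<and> is_direct_sum scale U (\<lambda>n. U \<inter> grade n)"

definition C2 ::
  "(complex \<Rightarrow> 'v::ab_group_add \<Rightarrow> 'v) \<Rightarrow> ('v \<Rightarrow> int \<Rightarrow> 'v \<Rightarrow> 'v) \<Rightarrow> 'v set" where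
  "C2 scale nprod = module.span scale {nprod u (-2) v | u v. True}"

text \<open>
  The list \<open>[(u1, n1), ..., (ur, nr)]\<close> encodes \<open>u1\<^sub>-\<^sub>n\<^sub>1 (... (ur\<^sub>-\<^sub>n\<^sub>r vac))\<close>.
\<close>

definition monomial_vector ::
  "'v \<Rightarrow> ('v \<Rightarrow> int \<Rightarrow> 'v \<Rightarrow> 'v) \<Rightarrow> ('v \<times> int) list \<Rightarrow> 'v" where
  "monomial_vector vac nprod ps = foldr (\<lambda>(u, n) w. nprod u (- n) w) ps vac"

definition monomial_vectors ::
  "'v \<Rightarrow> ('v \<Rightarrow> int \<Rightarrow> 'v \<Rightarrow> 'v) \<Rightarrow> 'v set \<Rightarrow> 'v set" where
  "monomial_vectors vac nprod U =
     {monomial_vector vac nprod ps | ps.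
        (\<forall>(u, n) \<in> set ps. u \<in> U \<and> n \<ge> 1) \<and> sorted_wrt (>) (map snd ps)}"

end

theory Submission
  imports Defs "HOL-Library.Multiset"
begin

text \<open>
  Let \<open>E\<^sub>n\<close> be spanned by the products \<open>u1\<^sub>-\<^sub>1\<^sub>-\<^sub>k\<^sub>1 \<dots> ur\<^sub>-\<^sub>1\<^sub>-\<^sub>k\<^sub>r vac\<close> with \<open>k1 + \<dots> + kr \<ge> n\<close>. By the Borcherds identity
  the factors commute modulo \<open>E\<^sub>n\<^sub>+\<^sub>1\<close>, and a factor with \<open>u \<in> C\<^sub>2\<close> raises the degree. So if \<open>V = U + C\<^sub>2\<close>, one may
  take all vectors in \<open>U\<close> and sort the modes; repeated modes are removed by expanding \<open>(a\<^sub>-\<^sub>1 b)\<^sub>-\<^sub>1\<^sub>-\<^sub>2\<^sub>k\<close>. Hence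
  \<open>V\<close> is the sum of the span of the monomials and \<open>E\<^sub>n\<close>, for every \<open>n\<close>. For each \<open>N\<close> some \<open>E\<^sub>n\<close> lies in the
  span of the vectors \<open>u\<^sub>-\<^sub>N v\<close>, which have conformal weight at least \<open>2t + N - 1\<close>, so projecting to a fixed
  conformal weight removes \<open>E\<^sub>n\<close>. Conversely, a monomial other than \<open>vac\<close> and \<open>u\<^sub>-\<^sub>1 vac\<close> has \<open>n1 \<ge> 2\<close> and lies
  in \<open>C\<^sub>2\<close>.
\<close>

section \<open>Sums of squares of mode indices\<close>

text \<open>Keeps the sum of squares within the square of the degree, so that the truncated
  subtraction in the termination measure of \<open>act_in_span_monomial_vectors\<close> really
  decreases.\<close>

lemma sum_list_squares_le: "(\<Sum>k\<leftarrow>ks. k\<^sup>2) \<le> (sum_list ks)\<^sup>2" for ks :: "nat list"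
  by (induction ks) (simp_all add: power2_sum)

lemma sum_squares_off_diagonal: "i + j = 2 * k \<Longrightarrow> i \<noteq> k \<Longrightarrow> 2 * k\<^sup>2 < i\<^sup>2 + j\<^sup>2" for i j k :: nat
proof -
  assume *: "i + j = 2 * k" "i \<noteq> k"
  define d where "d = int i - int k"
  have d: "int i = int k + d" "int j = int k - d" using *(1) by (auto simp: d_def)
  have "int (i\<^sup>2 + j\<^sup>2) = int (2 * k\<^sup>2) + 2 * d\<^sup>2"
    by (simp add: d power2_eq_square algebra_simps)
  moreover have "d\<^sup>2 > 0" using *(2) by (simp add: d_def)
  ultimately show ?thesis by linarith
qed

section \<open>Commutator and iterate formulas from the Borcherds identity\<close>

context vertex_algebra
begin

lemma nprod_add_left: "nprod (u + v) n w = nprod u n w + nprod v n w"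
  and nprod_scale_left: "nprod (scale c u) n w = scale c (nprod u n w)"
  and nprod_zero_left: "nprod 0 n w = 0"
  and nprod_add_right: "nprod w n (u + v) = nprod w n u + nprod w n v"
  and nprod_diff_right: "nprod w n (u - v) = nprod w n u - nprod w n v"
  and nprod_scale_right: "nprod w n (scale c u) = scale c (nprod w n u)"
  and nprod_zero_right: "nprod w n 0 = 0"
proof -
  interpret l: Vector_Spaces.linear scale scale "\<lambda>u. nprod u n w" by (rule linear_left)
  interpret r: Vector_Spaces.linear scale scale "\<lambda>v. nprod w n v" by (rule linear_right)
  show "nprod (u + v) n w = nprod u n w + nprod v n w"
    "nprod (scale c u) n w = scale c (nprod u n w)"
    "nprod 0 n w = 0"
    "nprod w n (u + v) = nprod w n u + nprod w n v"
    "nprod w n (u - v) = nprod w n u - nprod w n v"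
    "nprod w n (scale c u) = scale c (nprod w n u)"
    "nprod w n 0 = 0"
    by (rule l.add l.scale l.zero r.add r.diff r.scale r.zero)+
qed

lemma span_preserving:
  assumes "subspace W" "\<And>g. g \<in> G \<Longrightarrow> f g \<in> W" "x \<in> span G"
    and "\<And>x y. f (x + y) = f x + f y" "\<And>c x. f (scale c x) = scale c (f x)" "f 0 = 0"
  shows "f x \<in> W"
proof -
  have "subspace {x. f x \<in> W}"
    using assms(1) assms(4-6) by (auto simp: subspace_def)
  then show ?thesis
    using span_induct[OF assms(3), of "\<lambda>x. f x \<in> W"] assms(2) by auto
qed

lemma nprod_right_in:
  assumes "subspace W" "\<And>g. g \<in> G \<Longrightarrow> nprod u n g \<in> W" "x \<in> span G"
  shows "nprod u n x \<in> W"
  using assms by (rule span_preserving) (simp_all add: nprod_add_right nprod_scale_right nprod_zero_right)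

lemma nprod_left_in:
  assumes "subspace W" "\<And>g. g \<in> G \<Longrightarrow> nprod g n x \<in> W" "u \<in> span G"
  shows "nprod u n x \<in> W"
  using assms by (rule span_preserving[where f = "\<lambda>u. nprod u n x"])
    (simp_all add: nprod_add_left nprod_scale_left nprod_zero_left)

lemma Sum_any_in:
  assumes "subspace W" "\<And>i. f i \<in> W"
  shows "Sum_any f \<in> W"
  \<comment> \<open>On infinite support both sides have the default value 0, which also lies in
    \<open>W\<close>; so membership can be checked term by term.\<close>
  unfolding Sum_any.expand_set using assms by (intro subspace_sum) auto

text \<open>Collapses a sum of the Borcherds identity to its term \<open>i = 0\<close>: at
  \<open>l = 0\<close> this leaves the commutator formula, at \<open>m = 0\<close> the iterate
  formula.\<close>

lemma Sum_any_gchoose_zero: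
  "Sum_any (\<lambda>i::nat. scale (c i * (0 gchoose i)) (f i)) = scale (c 0) (f 0)"
proof -
  have "Sum_any (\<lambda>i::nat. scale (c i * (0 gchoose i)) (f i))
      = sum (\<lambda>i::nat. scale (c i * (0 gchoose i)) (f i)) {0}"
    by (rule Sum_any.expand_superset) (auto simp: gbinomial_0_left intro: ccontr split: if_splits)
  then show ?thesis by simp
qed

text \<open>The commutator of \<open>u_m\<close> and \<open>v_n\<close> is a combination of the
  modes \<open>(u_i v)_(m+n-i)\<close>. Later arguments work modulo a subspace, so the coefficients
  are dropped.\<close>

lemma commutator_in:
  assumes "subspace W" "\<And>i::nat. nprod (nprod u (int i) v) (m + n - int i) w \<in> W"
  shows "nprod u m (nprod v n w) - nprod v n (nprod u m w) \<in> W"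
proof -
  have "nprod u m (nprod v n w) - nprod v n (nprod u m w)
      = Sum_any (\<lambda>i::nat. scale (of_int m gchoose i)
           (nprod (nprod u (int i) v) (m + n - int i) w))"
    using jacobi[of 0 u m v n w]
      Sum_any_gchoose_zero[of "\<lambda>i. (-1) ^ i" "\<lambda>i. nprod u (m - int i) (nprod v (n + int i) w)"]
      Sum_any_gchoose_zero[of "\<lambda>i. (-1) ^ i" "\<lambda>i. nprod v (n - int i) (nprod u (m + int i) w)"]
    by simp
  also have "\<dots> \<in> W"
    using assms by (intro Sum_any_in subspace_scale)
  finally show ?thesis .
qed

lemma iterate_formula:
  "nprod (nprod u l v) n w =
    Sum_any (\<lambda>i::nat. scale ((-1) ^ i * (of_int l gchoose i))
           (nprod u (l - int i) (nprod v (n + int i) w)))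
    - Sum_any (\<lambda>i::nat. scale ((-1) powi l * (-1) ^ i * (of_int l gchoose i))
           (nprod v (n + l - int i) (nprod u (int i) w)))"
  using jacobi[of l u 0 v n w]
    Sum_any_gchoose_zero[of "\<lambda>i. 1" "\<lambda>i. nprod (nprod u (l + int i) v) (n - int i) w"]
  by simp

lemma iterate_leading_term:
  fixes k :: nat
  assumes W: "subspace W"
    and 1: "\<And>i::nat. i \<noteq> k \<Longrightarrow> nprod u (l - int i) (nprod v (n + int i) w) \<in> W"
    and 2: "\<And>i::nat. nprod v (n + l - int i) (nprod u (int i) w) \<in> W"
  shows "nprod (nprod u l v) n w
    - scale ((-1) ^ k * (of_int l gchoose k)) (nprod u (l - int k) (nprod v (n + int k) w)) \<in> W"
proof -
  define f where "f = (\<lambda>i::nat. scale ((-1) ^ i * (of_int l gchoose i))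
           (nprod u (l - int i) (nprod v (n + int i) w)))"
  \<comment> \<open>Splitting off the term \<open>i = k\<close> requires the true sum rather than
    the default 0 of \<open>Sum_any\<close>; truncation makes the support finite.\<close>
  obtain N where N: "\<forall>j\<ge>N. nprod v j w = 0" using truncation by blast
  have "f i = 0" if "i > nat (N - n)" for i
    using that N unfolding f_def by (simp add: nprod_zero_right)
  then have "{i. f i \<noteq> 0} \<subseteq> {..nat (N - n)}" by (auto simp: not_less[symmetric])
  then have fin: "finite {i. f i \<noteq> 0}" using finite_subset by blast
  have "Sum_any f = sum f (insert k {i. f i \<noteq> 0})"
    using fin by (intro Sum_any.expand_superset) auto
  also have "\<dots> = f k + sum f ({i. f i \<noteq> 0} - {k})"
    using fin by (subst sum.insert_remove) auto
  finally have "Sum_any f - f k = sum f ({i. f i \<noteq> 0} - {k})" by simp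
  also have "\<dots> \<in> W"
    using W 1 by (auto intro!: subspace_sum subspace_scale simp: f_def)
  finally have a: "Sum_any f - f k \<in> W" .
  have b: "Sum_any (\<lambda>i::nat. scale ((-1) powi l * (-1) ^ i * (of_int l gchoose i))
           (nprod v (n + l - int i) (nprod u (int i) w))) \<in> W"
    using W 2 by (intro Sum_any_in subspace_scale)
  have eq: "nprod (nprod u l v) n w - f k = (Sum_any f - f k) -
    Sum_any (\<lambda>i::nat. scale ((-1) powi l * (-1) ^ i * (of_int l gchoose i))
           (nprod v (n + l - int i) (nprod u (int i) w)))"
    unfolding iterate_formula[of u l v n w] f_def by (simp add: diff_right_commute)
  then have "nprod (nprod u l v) n w - f k \<in> W"
    using subspace_diff[OF W a b] by (simp only: eq)
  then show ?thesis by (simp only: f_def)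
qed

lemma iterate_in:
  assumes W: "subspace W"
    and "\<And>i::nat. nprod u (l - int i) (nprod v (n + int i) w) \<in> W"
    and "\<And>i::nat. nprod v (n + l - int i) (nprod u (int i) w) \<in> W"
  shows "nprod (nprod u l v) n w \<in> W"
  unfolding iterate_formula[of u l v n w]
  using assms by (intro subspace_diff Sum_any_in subspace_scale)

lemma normal_product_leading_term:
  fixes k :: nat
  assumes "subspace W"
    and "\<And>i::nat. i \<noteq> k \<Longrightarrow> nprod u (-1 - int i) (nprod v (n + int i) w) \<in> W"
    and "\<And>i::nat. nprod v (n - 1 - int i) (nprod u (int i) w) \<in> W"
  shows "nprod (nprod u (-1) v) n w - nprod u (-1 - int k) (nprod v (n + int k) w) \<in> W"
proof -
  have "((-1) ^ k * (- 1 gchoose k) :: complex) = 1"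
    using gbinomial_minus[of "1::complex" k] binomial_gbinomial[of k k, where 'a=complex]
    by (simp flip: power_mult_distrib)
  then show ?thesis
    using iterate_leading_term[of W k u "-1" v n w] assms by simp
qed

text \<open>\<open>vac\<close> has only the mode -1, so a single term of the iterate expansion
  survives. With \<open>D u = u_{-2} vac\<close> this is the familiar
  \<open>(D u)_n = - n u_(n-1)\<close>.\<close>

lemma nprod_derivative:
  "nprod (nprod u (-2) vac) (-1 - int k) w = scale (of_nat (Suc k)) (nprod u (-2 - int k) w)"
proof -
  have "((-1) ^ k * (- 2 gchoose k) :: complex) = of_nat (Suc k)"
    using gbinomial_minus[of "2::complex" k] binomial_gbinomial[of "Suc k" k, where 'a=complex]
    by (simp add: add.commute flip: power_mult_distrib mult.assoc)
  then show ?thesis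
    using iterate_leading_term[of "{0}" k u "-2" vac "-1 - int k" w]
    by (simp add: vacuum nprod_zero_right)
qed

section \<open>Products of negative modes and the filtration \<open>E\<close>\<close>

text \<open>The pair \<open>(u, k)\<close> stands for the mode \<open>-1 - k\<close>, so that a
  factor \<open>u_{-1}\<close> has degree 0 and degrees add up along a product.\<close>

definition act :: "('v \<times> nat) list \<Rightarrow> 'v \<Rightarrow> 'v" where
  "act ps x = foldr (\<lambda>(u, k). nprod u (-1 - int k)) ps x"

lemma act_Nil [simp]: "act [] x = x"
  and act_Cons [simp]: "act ((u, k) # ps) x = nprod u (-1 - int k) (act ps x)"
  and act_append: "act (ps @ qs) x = act ps (act qs x)"
  by (simp_all add: act_def)

definition degree :: "('v \<times> nat) list \<Rightarrow> nat" where
  "degree ps = sum_list (map snd ps)"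

lemma degree_simps [simp]: "degree [] = 0" "degree ((u, k) # ps) = k + degree ps"
  "degree (ps @ qs) = degree ps + degree qs"
  by (simp_all add: degree_def)

text \<open>Li's decreasing filtration. The index is an integer because nonnegative modes may push
  the bound below 0, where the filtration is all of \<open>V\<close>.\<close>

definition E :: "int \<Rightarrow> 'v set" where
  "E n = span {act ps vac | ps. n \<le> int (degree ps)}"

lemma subspace_E: "subspace (E n)"
  by (simp add: E_def)

lemma act_in_E: "n \<le> int (degree ps) \<Longrightarrow> act ps vac \<in> E n"
  unfolding E_def by (rule span_base) blast

lemma E_antimono: "m \<le> n \<Longrightarrow> x \<in> E n \<Longrightarrow> x \<in> E m"
  unfolding E_def by (erule set_rev_mp, rule span_mono) auto

lemma E_nonpos: "n \<le> 0 \<Longrightarrow> x \<in> E n"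
  using act_in_E[of n "[(x, 0)]"] by (simp add: creation)

lemma nprod_neg_in_E:
  assumes "x \<in> E n" "m \<le> n + int k"
  shows "nprod u (-1 - int k) x \<in> E m"
proof (rule nprod_right_in[OF subspace_E])
  show "x \<in> span {act ps vac | ps. n \<le> int (degree ps)}"
    using assms(1) by (simp add: E_def)
next
  fix g assume "g \<in> {act ps vac | ps. n \<le> int (degree ps)}"
  then obtain ps where "g = act ps vac" "n \<le> int (degree ps)" by blast
  then show "nprod u (-1 - int k) g \<in> E m"
    using act_in_E[of m "(u, k) # ps"] assms(2) by simp
qed

text \<open>Move \<open>a_i\<close> past the first factor; the commutator terms are modes of
  \<open>a_j b\<close>, which is why the induction is over all \<open>a\<close>. The loss is
  \<open>i\<close>, not the \<open>i + 1\<close> of the uniform bound \<open>nprod_in_E\<close>; the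
  removal of repeated modes uses this extra unit.\<close>

lemma nprod_nonneg_act_in_E:
  "nprod a (int i) (act ps vac) \<in> E (int (degree ps) - int i)"
proof (induction ps arbitrary: a i)
  case Nil
  then show ?case by (simp add: creation subspace_0 subspace_E)
next
  case (Cons p ps)
  obtain b k where p: "p = (b, k)" by (cases p)
  let ?x = "act ps vac" and ?m = "int (degree ps) + int k - int i"
  have 1: "nprod b (-1 - int k) (nprod a (int i) ?x) \<in> E ?m"
    by (rule nprod_neg_in_E[OF Cons.IH]) simp
  have 2: "nprod a (int i) (nprod b (-1 - int k) ?x) - nprod b (-1 - int k) (nprod a (int i) ?x) \<in> E ?m"
  proof (rule commutator_in[OF subspace_E])
    fix j :: nat
    let ?c = "nprod a (int j) b" and ?q = "int i + (-1 - int k) - int j"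
    show "nprod ?c ?q ?x \<in> E ?m"
    proof (cases "?q \<ge> 0")
      case True
      then obtain q where q: "?q = int q" using nonneg_int_cases by blast
      show ?thesis unfolding q by (rule E_antimono[OF _ Cons.IH]) (use q in linarith)
    next
      case False
      define q where "q = k + j - i"
      have q: "?q = -1 - int q" using False by (simp add: q_def)
      show ?thesis unfolding q by (rule nprod_neg_in_E[OF act_in_E[OF order_refl]]) (use q in linarith)
    qed
  qed
  show ?case using subspace_add[OF subspace_E 1 2] by (simp add: p add.commute)
qed

lemma nprod_nonneg_in_E:
  assumes "x \<in> E n" "m \<le> n - int i"
  shows "nprod u (int i) x \<in> E m"
proof (rule nprod_right_in[OF subspace_E])
  show "x \<in> span {act ps vac | ps. n \<le> int (degree ps)}"
    using assms(1) by (simp add: E_def)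
next
  fix g assume "g \<in> {act ps vac | ps. n \<le> int (degree ps)}"
  then obtain ps where "g = act ps vac" "n \<le> int (degree ps)" by blast
  then show "nprod u (int i) g \<in> E m"
    using E_antimono[OF _ nprod_nonneg_act_in_E[of u i ps]] assms(2) by simp
qed

lemma nprod_in_E:
  assumes "x \<in> E n" "m \<le> n - p - 1"
  shows "nprod u p x \<in> E m"
proof (cases "p \<ge> 0")
  case True
  then show ?thesis using nprod_nonneg_in_E[of x n m "nat p"] assms by simp
next
  case False
  then show ?thesis using nprod_neg_in_E[of x n m "nat (-1 - p)"] assms by simp
qed

text \<open>
  The index is shifted by one: \<open>C k\<close> is \<open>C\<^sub>k\<^sub>+\<^sub>1(V)\<close> in the usual notation.
\<close>

definition C :: "nat \<Rightarrow> 'v set" where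
  "C k = span {nprod u (-1 - int k) v | u v. True}"

lemma subspace_C: "subspace (C k)"
  by (simp add: C_def)

lemma nprod_in_C_base: "nprod u (-1 - int k) v \<in> C k"
  unfolding C_def by (rule span_base) blast

text \<open>In every term of the iterate expansion of \<open>(a_{-2} b)_{-1-k}\<close> the two modes
  sum to \<open>-3 - k\<close>. A mode \<open>p\<close> raises the degree by at least
  \<open>-p - 1\<close>, so the term gains at least \<open>k + 1\<close>.\<close>

lemma nprod_C1_in_E:
  assumes "c \<in> C 1" "x \<in> E n" "m \<le> n + int k + 1"
  shows "nprod c (-1 - int k) x \<in> E m"
proof (rule nprod_left_in[OF subspace_E])
  show "c \<in> span {nprod u (-2) v | u v. True}"
    using assms(1) by (simp add: C_def)
next
  fix g assume "g \<in> {nprod u (-2) v | u v. True}"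
  then obtain a b where g: "g = nprod a (-2) b" by blast
  show "nprod g (-1 - int k) x \<in> E m"
    unfolding g
  proof (rule iterate_in[OF subspace_E])
    fix i :: nat
    show "nprod a (-2 - int i) (nprod b (-1 - int k + int i) x) \<in> E m"
      by (rule nprod_in_E[OF nprod_in_E[OF assms(2) order_refl]]) (use assms(3) in linarith)
    show "nprod b (-1 - int k + -2 - int i) (nprod a (int i) x) \<in> E m"
      by (rule nprod_in_E[OF nprod_nonneg_in_E[OF assms(2) order_refl]]) (use assms(3) in linarith)
  qed
qed

section \<open>Reordering and reduction of products modulo higher degree\<close>

text \<open>Each commutator term merges \<open>u_{-1-k}\<close> and \<open>v_{-1-l}\<close> into one
  mode \<open>-2 - k - l - i\<close>, of degree at least \<open>k + l + 1\<close>: one more than the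
  two factors together.\<close>

lemma act_move_in_E:
  "nprod u (-1 - int k) (act (as @ bs) vac) - act (as @ (u, k) # bs) vac
     \<in> E (int k + int (degree as) + int (degree bs) + 1)"
proof (induction as)
  case Nil
  then show ?case by (simp add: subspace_0 subspace_E)
next
  case (Cons p as)
  obtain v l where p: "p = (v, l)" by (cases p)
  let ?x = "act (as @ bs) vac"
  let ?n = "int k + int (degree (p # as)) + int (degree bs) + 1"
  have 1: "nprod u (-1 - int k) (nprod v (-1 - int l) ?x)
      - nprod v (-1 - int l) (nprod u (-1 - int k) ?x) \<in> E ?n"
    by (rule commutator_in[OF subspace_E], rule nprod_in_E[OF act_in_E[OF order_refl]]) (simp add: p)
  have 2: "nprod v (-1 - int l) (nprod u (-1 - int k) ?x - act (as @ (u, k) # bs) vac) \<in> E ?n"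
    by (rule nprod_neg_in_E[OF Cons.IH]) (simp add: p)
  show ?case
    using subspace_add[OF subspace_E 1 2] by (simp add: p nprod_diff_right)
qed

lemma act_permute_in_E:
  assumes "mset ps = mset qs"
  shows "act ps vac - act qs vac \<in> E (int (degree ps) + 1)"
  using assms
proof (induction ps arbitrary: qs)
  case Nil
  then have "qs = []" by simp
  then show ?case by (simp add: subspace_0 subspace_E)
next
  case (Cons p ps)
  obtain u k where p: "p = (u, k)" by (cases p)
  have "p \<in> set qs" using Cons.prems by (metis list.set_intros(1) set_mset_mset)
  then obtain as bs where qs: "qs = as @ p # bs" by (meson split_list)
  then have ps: "mset ps = mset (as @ bs)" using Cons.prems by simp
  then have deg: "degree ps = degree (as @ bs)"
    unfolding degree_def by (metis mset_map sum_mset_sum_list)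
  have 1: "nprod u (-1 - int k) (act ps vac - act (as @ bs) vac) \<in> E (int (degree (p # ps)) + 1)"
    by (rule nprod_neg_in_E[OF Cons.IH[OF ps]]) (simp add: p)
  have 2: "nprod u (-1 - int k) (act (as @ bs) vac) - act qs vac \<in> E (int (degree (p # ps)) + 1)"
    using act_move_in_E[of u k as bs] by (simp add: p qs deg ac_simps)
  show ?case
    using subspace_add[OF subspace_E 1 2] by (simp add: p nprod_diff_right)
qed

lemma act_reduce_in_E:
  assumes "\<And>v. \<exists>u\<in>U. v - u \<in> C 1"
  shows "\<exists>qs. fst ` set qs \<subseteq> U \<and> degree qs = degree ps
     \<and> act ps vac - act qs vac \<in> E (int (degree ps) + 1)"
proof (induction ps)
  case Nil
  then show ?case by (intro exI[of _ "[]"]) (simp add: subspace_0 subspace_E)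
next
  case (Cons p ps)
  obtain v k where p: "p = (v, k)" by (cases p)
  obtain qs where qs: "fst ` set qs \<subseteq> U" "degree qs = degree ps"
    "act ps vac - act qs vac \<in> E (int (degree ps) + 1)" using Cons.IH by blast
  obtain u where u: "u \<in> U" "v - u \<in> C 1" using assms by blast
  have 1: "nprod u (-1 - int k) (act ps vac - act qs vac) \<in> E (int (degree (p # ps)) + 1)"
    by (rule nprod_neg_in_E[OF qs(3)]) (simp add: p)
  have 2: "nprod (v - u) (-1 - int k) (act ps vac) \<in> E (int (degree (p # ps)) + 1)"
    by (rule nprod_C1_in_E[OF u(2) act_in_E[OF order_refl]]) (simp add: p)
  have "nprod v (-1 - int k) (act ps vac) =
      nprod (v - u) (-1 - int k) (act ps vac) + nprod u (-1 - int k) (act ps vac)"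
    by (simp flip: nprod_add_left)
  then show ?case
    using subspace_add[OF subspace_E 1 2] qs u
    by (intro exI[of _ "(u, k) # qs"]) (simp add: p nprod_diff_right algebra_simps)
qed

lemma monomial_vector_act: "monomial_vector vac nprod (map (\<lambda>(u, k). (u, 1 + int k)) ps) = act ps vac"
  by (induction ps) (auto simp: monomial_vector_def)

lemma monomial_vectors_act:
  "monomial_vectors vac nprod U =
     {act ps vac | ps. fst ` set ps \<subseteq> U \<and> sorted_wrt (>) (map snd ps)}"
proof (intro set_eqI iffI)
  fix x assume "x \<in> monomial_vectors vac nprod U"
  then obtain ps where ps: "x = monomial_vector vac nprod ps"
    "\<forall>(u, n) \<in> set ps. u \<in> U \<and> n \<ge> 1" "sorted_wrt (>) (map snd ps)"
    unfolding monomial_vectors_def by blast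
  define qs where "qs = map (\<lambda>(u, n). (u, nat (n - 1))) ps"
  have "ps = map (\<lambda>(u, k). (u, 1 + int k)) qs"
    unfolding qs_def map_map using ps(2) by (intro map_idI[symmetric]) auto
  then have 1: "x = act qs vac" using ps(1) by (simp add: monomial_vector_act)
  have 2: "fst ` set qs \<subseteq> U" using ps(2) unfolding qs_def by force
  have 3: "sorted_wrt (>) (map snd qs)"
    using ps(3) unfolding qs_def sorted_wrt_map
    by (rule sorted_wrt_mono_rel[rotated]) (use ps(2) in fastforce)
  show "x \<in> {act ps vac | ps. fst ` set ps \<subseteq> U \<and> sorted_wrt (>) (map snd ps)}"
    using 1 2 3 by blast
next
  fix x assume "x \<in> {act ps vac | ps. fst ` set ps \<subseteq> U \<and> sorted_wrt (>) (map snd ps)}"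
  then obtain ps where ps: "x = act ps vac" "fst ` set ps \<subseteq> U" "sorted_wrt (>) (map snd ps)"
    by blast
  have "sorted_wrt (>) (map snd (map (\<lambda>(u, k). (u, 1 + int k)) ps))"
    using ps(3) by (induction ps) auto
  then show "x \<in> monomial_vectors vac nprod U"
    unfolding monomial_vectors_def
    using ps by (intro CollectI exI[of _ "map (\<lambda>(u, k). (u, 1 + int k)) ps"])
      (auto simp: monomial_vector_act)
qed

lemma distinct_act_in_span:
  assumes "fst ` set ps \<subseteq> U" "distinct (map snd ps)"
  shows "act ps vac \<in> span (monomial_vectors vac nprod U \<union> E (int (degree ps) + 1))"
proof -
  define qs where "qs = rev (sort_key snd ps)"
  have m: "mset ps = mset qs" by (simp add: qs_def)
  then have "distinct (map snd qs)"
    using assms(2) by (metis mset_map mset_eq_imp_distinct_iff)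
  then have "sorted_wrt (<) (map snd (sort_key snd ps))"
    by (simp add: qs_def strict_sorted_iff flip: rev_map)
  then have "sorted_wrt (>) (map snd qs)"
    by (simp add: qs_def sorted_wrt_rev flip: rev_map)
  moreover have "set qs = set ps" using m by (metis set_mset_mset)
  ultimately have 1: "act qs vac \<in> monomial_vectors vac nprod U"
    unfolding monomial_vectors_act using assms(1) by blast
  have 2: "act ps vac - act qs vac \<in> E (int (degree ps) + 1)"
    by (rule act_permute_in_E[OF m])
  have "act qs vac + (act ps vac - act qs vac)
    \<in> span (monomial_vectors vac nprod U \<union> E (int (degree ps) + 1))"
    using 1 2 by (intro span_add span_base) auto
  then show ?thesis by simp
qed

text \<open>
  A repeated mode \<open>a\<^sub>-\<^sub>1\<^sub>-\<^sub>k b\<^sub>-\<^sub>1\<^sub>-\<^sub>k\<close> is the diagonal term of the expansion of \<open>(a\<^sub>-\<^sub>1 b)\<^sub>-\<^sub>1\<^sub>-\<^sub>2\<^sub>k\<close>. The field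
  \<open>(a\<^sub>-\<^sub>1 b)\<^sub>-\<^sub>1\<^sub>-\<^sub>2\<^sub>k\<close> gives a shorter product once \<open>a\<^sub>-\<^sub>1 b\<close> is replaced by an element of \<open>U\<close>, and the other terms of the
  same weight have modes \<open>i + j = 2k\<close> with a larger sum of squares, which is bounded by the square of
  the total weight.
\<close>

lemma act_in_span_monomial_vectors:
  assumes "\<And>v. \<exists>u\<in>U. v - u \<in> C 1" "fst ` set ps \<subseteq> U"
  shows "act ps vac \<in> span (monomial_vectors vac nprod U \<union> E (int (degree ps) + 1))"
  using assms(2)
proof (induction ps rule: wf_induct_rule[OF wf_measures[of
      "[length, \<lambda>ps. (degree ps)\<^sup>2 - (\<Sum>k\<leftarrow>map snd ps. k\<^sup>2)]"]])
  case (1 ps)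
  define T where "T = span (monomial_vectors vac nprod U \<union> E (int (degree ps) + 1))"
  have sT: "subspace T" by (simp add: T_def)
  have ET: "x \<in> T" if "x \<in> E (int (degree ps) + 1)" for x
    using that unfolding T_def by (intro span_base) simp
  have IH: "act qs vac \<in> T"
    if "fst ` set qs \<subseteq> U" "degree qs = degree ps"
      "length qs < length ps \<or> length qs = length ps \<and>
        (\<Sum>k\<leftarrow>map snd ps. k\<^sup>2) < (\<Sum>k\<leftarrow>map snd qs. k\<^sup>2)" for qs
  proof -
    have "(\<Sum>k\<leftarrow>map snd qs. k\<^sup>2) \<le> (degree ps)\<^sup>2"
      using sum_list_squares_le[of "map snd qs"] that(2) by (simp add: degree_def)
    then have "(qs, ps) \<in> measures [length, \<lambda>ps. (degree ps)\<^sup>2 - (\<Sum>k\<leftarrow>map snd ps. k\<^sup>2)]"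
      using that(2,3) by auto
    then show ?thesis using "1.IH"[of qs] that(1,2) by (simp add: T_def)
  qed
  have "act ps vac \<in> T"
  proof (cases "distinct (map snd ps)")
    case True
    then show ?thesis unfolding T_def by (rule distinct_act_in_span[OF "1.prems"])
  next
    case False
    then obtain xs ys zs k where "map snd ps = xs @ [k] @ ys @ [k] @ zs"
      using not_distinct_decomp by blast
    then obtain as bs cs a b where "ps = as @ [(a, k)] @ bs @ [(b, k)] @ cs"
      by (fastforce simp: map_eq_append_conv append_eq_map_conv map_eq_Cons_conv Cons_eq_map_conv)
    then have "mset ps = mset ((a, k) # (b, k) # as @ bs @ cs)" by simp
    then obtain rs where m: "mset ps = mset ((a, k) # (b, k) # rs)" by blast
    then have sps: "set ps = set ((a, k) # (b, k) # rs)" by (metis set_mset_mset)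
    have dps: "degree ps = 2 * k + degree rs"
      using arg_cong[OF m, of "\<lambda>M. sum_mset (image_mset snd M)"]
      by (simp add: degree_def sum_mset_sum_list flip: mset_map)
    have lps: "length ps = Suc (Suc (length rs))"
      using arg_cong[OF m, of size] by simp
    have qps: "(\<Sum>k\<leftarrow>map snd ps. k\<^sup>2) = 2 * k\<^sup>2 + (\<Sum>k\<leftarrow>map snd rs. k\<^sup>2)"
      using arg_cong[OF m, of "\<lambda>M. sum_mset (image_mset (\<lambda>p. (snd p)\<^sup>2) M)"]
      by (simp add: sum_mset_sum_list o_def flip: mset_map)
    have U: "a \<in> U" "b \<in> U" "fst ` set rs \<subseteq> U" using "1.prems" sps by auto
    let ?y = "act rs vac" and ?n = "-1 - int (2 * k)"
    have y: "?y \<in> E (int (degree rs))" by (rule act_in_E) simp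
    obtain u where u: "u \<in> U" "nprod a (-1) b - u \<in> C 1" using assms(1) by blast
    have 1: "nprod (nprod a (-1) b) ?n ?y - nprod a (-1 - int k) (nprod b (?n + int k) ?y) \<in> T"
    proof (rule normal_product_leading_term[OF sT])
      fix i :: nat
      assume i: "i \<noteq> k"
      \<comment> \<open>For \<open>i \<le> 2k\<close> both modes are negative, and the induction
        hypothesis applies by the larger sum of squares. For \<open>i > 2k\<close> the inner mode is
        nonnegative, and the term has degree above that of \<open>ps\<close>.\<close>
      show "nprod a (-1 - int i) (nprod b (?n + int i) ?y) \<in> T"
      proof (cases "i \<le> 2 * k")
        case True
        define j where "j = 2 * k - i"
        have j: "i + j = 2 * k" "?n + int i = -1 - int j" using True by (auto simp: j_def)
        have "act ((a, i) # (b, j) # rs) vac \<in> T"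
          by (rule IH) (use U j sum_squares_off_diagonal[OF j(1) i] in \<open>auto simp: dps lps qps[simplified]\<close>)
        then show ?thesis unfolding j(2) by simp
      next
        case False
        define j where "j = i - 2 * k - 1"
        have j: "?n + int i = int j" using False by (simp add: j_def)
        show ?thesis
          unfolding j
          by (rule ET, rule nprod_neg_in_E[OF nprod_nonneg_in_E[OF y order_refl]])
            (use j in \<open>simp add: dps\<close>)
      qed
    next
      fix i :: nat
      show "nprod b (?n - 1 - int i) (nprod a (int i) ?y) \<in> T"
        by (rule ET, rule nprod_in_E[OF nprod_nonneg_in_E[OF y order_refl]]) (simp add: dps)
    qed
    have 2: "nprod (nprod a (-1) b - u) ?n ?y \<in> T"
      by (rule ET, rule nprod_C1_in_E[OF u(2) y]) (simp add: dps)
    have "act ((u, 2 * k) # rs) vac \<in> T"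
      by (rule IH) (use U u in \<open>auto simp: dps lps\<close>)
    then have 3: "nprod u ?n ?y \<in> T" by simp
    have 4: "act ps vac - act ((a, k) # (b, k) # rs) vac \<in> T"
      by (rule ET, rule act_permute_in_E[OF m])
    have "act ps vac = (act ps vac - act ((a, k) # (b, k) # rs) vac)
        + (nprod (nprod a (-1) b - u) ?n ?y + nprod u ?n ?y)
        - (nprod (nprod a (-1) b) ?n ?y - nprod a (-1 - int k) (nprod b (?n + int k) ?y))"
      by (simp add: algebra_simps flip: nprod_add_left)
    then show ?thesis
      using sT 1 2 3 4 by (metis subspace_add subspace_diff)
  qed
  then show ?case by (simp add: T_def)
qed

text \<open>Starts from \<open>E 0 = V\<close>; each step trades the products of degree exactly
  \<open>n\<close> for monomials modulo \<open>E (n + 1)\<close>.\<close>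

lemma in_span_monomial_vectors_E:
  assumes "\<And>v. \<exists>u\<in>U. v - u \<in> C 1"
  shows "x \<in> span (monomial_vectors vac nprod U \<union> E (int n))"
proof (induction n)
  case 0
  then show ?case by (intro span_base) (simp add: E_nonpos)
next
  case (Suc n)
  let ?T = "span (monomial_vectors vac nprod U \<union> E (int (Suc n)))"
  have ET: "x \<in> ?T" if "x \<in> E (int (Suc n))" for x
    using that by (intro span_base) simp
  have "act ps vac \<in> ?T" if n: "int n \<le> int (degree ps)" for ps
  proof (cases "degree ps = n")
    case True
    obtain qs where qs: "fst ` set qs \<subseteq> U" "degree qs = degree ps"
      "act ps vac - act qs vac \<in> E (int (degree ps) + 1)" using act_reduce_in_E[OF assms] by blast
    have "act qs vac \<in> ?T"
      using act_in_span_monomial_vectors[OF assms qs(1)] qs(2) True by (simp add: add.commute)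
    moreover have "act ps vac - act qs vac \<in> ?T"
      using qs(3) True by (intro ET) (simp add: add.commute)
    ultimately show ?thesis by (metis diff_add_cancel span_add)
  next
    case False
    then show ?thesis using n by (intro ET act_in_E) simp
  qed
  then have "E (int n) \<subseteq> ?T"
    unfolding E_def[of "int n"] by (intro span_minimal) auto
  moreover have "monomial_vectors vac nprod U \<subseteq> ?T"
    by (auto intro: span_base)
  ultimately have "span (monomial_vectors vac nprod U \<union> E (int n)) \<subseteq> ?T"
    by (intro span_minimal) auto
  then show ?case using Suc by blast
qed

section \<open>The subspaces \<open>C k\<close> and their comparison with \<open>E\<close>\<close>

text \<open>\<open>u_{-2-l}\<close> is a multiple of the mode \<open>-1 - l\<close> of the
  derivative of \<open>u\<close>, since \<open>l + 1\<close> is invertible in the complex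
  numbers.\<close>

lemma C_antimono: "l \<le> k \<Longrightarrow> C k \<subseteq> C l"
proof (induction rule: inc_induct)
  case (step l)
  have "nprod u (-1 - int (Suc l)) v \<in> C l" for u v
  proof -
    have "scale (of_nat (Suc l)) (nprod u (-2 - int l) v) \<in> C l"
      using nprod_in_C_base[of "nprod u (-2) vac" l v] by (simp only: nprod_derivative)
    then have "scale (inverse (of_nat (Suc l))) (scale (of_nat (Suc l)) (nprod u (-2 - int l) v)) \<in> C l"
      by (rule subspace_scale[OF subspace_C])
    then have "nprod u (-2 - int l) v \<in> C l" by (simp del: of_nat_Suc)
    moreover have "-1 - int (Suc l) = -2 - int l" by simp
    ultimately show ?thesis by metis
  qed
  then have "C (Suc l) \<subseteq> C l"
    unfolding C_def[of "Suc l"] by (intro span_minimal subspace_C) blast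
  then show ?case using step by blast
qed simp

lemma nprod_neg_in_C: "k \<le> l \<Longrightarrow> n = -1 - int l \<Longrightarrow> nprod u n v \<in> C k"
  using nprod_in_C_base C_antimono by blast

text \<open>Commuting \<open>u_{-1-l}\<close> past \<open>a_{-1-k}\<close> creates only modes below
  \<open>-1 - k\<close>.\<close>

lemma nprod_neg_stabilises_C:
  assumes "x \<in> C k"
  shows "nprod u (-1 - int l) x \<in> C k"
proof (rule nprod_right_in[OF subspace_C _ assms[unfolded C_def]])
  fix g assume "g \<in> {nprod u (-1 - int k) v | u v. True}"
  then obtain a b where g: "g = nprod a (-1 - int k) b" by blast
  have "nprod u (-1 - int l) g - nprod a (-1 - int k) (nprod u (-1 - int l) b) \<in> C k"
    unfolding g
  proof (rule commutator_in[OF subspace_C])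
    fix i :: nat
    show "nprod (nprod u (int i) a) (-1 - int l + (-1 - int k) - int i) b \<in> C k"
      by (rule nprod_neg_in_C[of _ "k + l + i + 1"]) simp_all
  qed
  then show "nprod u (-1 - int l) g \<in> C k"
    using subspace_add[OF subspace_C _ nprod_in_C_base] by (metis diff_add_cancel)
qed

text \<open>
  As before, \<open>c\<^sub>-\<^sub>1\<^sub>-\<^sub>k e\<^sub>-\<^sub>1\<^sub>-\<^sub>k\<close> is the diagonal term of \<open>(c\<^sub>-\<^sub>1 e)\<^sub>-\<^sub>1\<^sub>-\<^sub>2\<^sub>k\<close>; in every other term one of the two modes
  exceeds \<open>k\<close>.
\<close>

lemma nprod_C_in_C_Suc:
  assumes "k \<ge> 1" "x \<in> C k"
  shows "nprod c (-1 - int k) x \<in> C (Suc k)"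
proof (rule nprod_right_in[OF subspace_C _ assms(2)[unfolded C_def]])
  fix g assume "g \<in> {nprod u (-1 - int k) v | u v. True}"
  then obtain e f where g: "g = nprod e (-1 - int k) f" by blast
  let ?n = "-1 - int (2 * k)"
  have 1: "nprod (nprod c (-1) e) ?n f - nprod c (-1 - int k) (nprod e (?n + int k) f) \<in> C (Suc k)"
  proof (rule normal_product_leading_term[OF subspace_C])
    fix i :: nat
    assume "i \<noteq> k"
    then consider "i \<ge> Suc k" | "i < k" by linarith
    then show "nprod c (-1 - int i) (nprod e (?n + int i) f) \<in> C (Suc k)"
    proof cases
      case 1
      then show ?thesis by (rule nprod_neg_in_C) simp
    next
      case 2
      then show ?thesis
        by (intro nprod_neg_stabilises_C nprod_neg_in_C[of _ "2 * k - i"]) auto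
    qed
  next
    fix i :: nat
    show "nprod e (?n - 1 - int i) (nprod c (int i) f) \<in> C (Suc k)"
      by (rule nprod_neg_in_C[of _ "2 * k + 1 + i"]) auto
  qed
  \<comment> \<open>Here \<open>k \<ge> 1\<close> enters, through
    \<open>2k \<ge> k + 1\<close>.\<close>
  have 2: "nprod (nprod c (-1) e) ?n f \<in> C (Suc k)"
    by (rule nprod_neg_in_C[of _ "2 * k"]) (use assms(1) in auto)
  show "nprod c (-1 - int k) g \<in> C (Suc k)"
    using subspace_diff[OF subspace_C 2 1] by (simp add: g algebra_simps)
qed

lemma act_linear:
  "act ps (x + y) = act ps x + act ps y" "act ps (scale c x) = scale c (act ps x)" "act ps 0 = 0"
  by (induction ps) (auto simp: nprod_add_right nprod_scale_right nprod_zero_right)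

lemma act_in_C:
  assumes "(u, l) \<in> set ps" "l \<ge> k"
  shows "act ps x \<in> C k"
  using assms
proof (induction ps)
  case (Cons p ps)
  show ?case
  proof (cases "p = (u, l)")
    case True
    then show ?thesis using assms(2) nprod_neg_in_C[OF _ refl] by simp
  next
    case False
    then have "(u, l) \<in> set ps" using Cons.prems by auto
    then show ?thesis using Cons.IH assms(2) by (cases p) (simp add: nprod_neg_stabilises_C)
  qed
qed simp

lemma act_in_E_degree: "act ps x \<in> E (int (degree ps))"
  \<comment> \<open>Since \<open>x = x_{-1} vac\<close>, the vector \<open>x\<close> counts as one
    more factor, of degree 0.\<close>
  using act_in_E[of "int (degree ps)" "ps @ [(x, 0)]"] by (simp add: act_append creation)

text \<open>For \<open>x = c_{-1-k} d\<close>, pull \<open>c_{-1-k}\<close> to the front modulo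
  \<open>C (Suc k)\<close>. The rest, \<open>act ps d\<close>, lies in \<open>C k\<close> by the
  assumption on \<open>E\<close>, and \<open>c_{-1-k}\<close> maps \<open>C k\<close> into
  \<open>C (Suc k)\<close>.\<close>

lemma act_C_in_C_Suc:
  assumes k: "k \<ge> 1" and E: "E (int (degree ps)) \<subseteq> C k" and x: "x \<in> C k"
  shows "act ps x \<in> C (Suc k)"
proof (rule span_preserving[OF subspace_C _ x[unfolded C_def]])
  fix g assume "g \<in> {nprod u (-1 - int k) v | u v. True}"
  then obtain c d where g: "g = nprod c (-1 - int k) d" by blast
  have "act ps (nprod c (-1 - int k) d) - nprod c (-1 - int k) (act ps d) \<in> C (Suc k)"
  proof (induction ps)
    case Nil
    then show ?case by (simp add: subspace_0 subspace_C)
  next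
    case (Cons p ps)
    obtain a l where p: "p = (a, l)" by (cases p)
    have 1: "nprod a (-1 - int l) (act ps (nprod c (-1 - int k) d) - nprod c (-1 - int k) (act ps d))
        \<in> C (Suc k)"
      by (rule nprod_neg_stabilises_C[OF Cons.IH])
    have 2: "nprod a (-1 - int l) (nprod c (-1 - int k) (act ps d))
        - nprod c (-1 - int k) (nprod a (-1 - int l) (act ps d)) \<in> C (Suc k)"
    proof (rule commutator_in[OF subspace_C])
      fix i :: nat
      show "nprod (nprod a (int i) c) (-1 - int l + (-1 - int k) - int i) (act ps d) \<in> C (Suc k)"
        by (rule nprod_neg_in_C[of _ "k + l + i + 1"]) auto
    qed
    show ?case using subspace_add[OF subspace_C 1 2] by (simp add: p nprod_diff_right)
  qed
  moreover have "nprod c (-1 - int k) (act ps d) \<in> C (Suc k)"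
    using nprod_C_in_C_Suc[OF k] act_in_E_degree E by blast
  ultimately show "act ps g \<in> C (Suc k)"
    unfolding g using subspace_add[OF subspace_C] by (metis diff_add_cancel)
qed (rule act_linear)+

text \<open>The shortest prefix of degree at least \<open>m\<close> overshoots by at most
  \<open>k\<close>, the bound on a single factor.\<close>

lemma split_by_degree:
  assumes "\<forall>(u, l)\<in>set ps. l \<le> k" "m + k + r \<le> degree ps"
  shows "\<exists>as bs. ps = as @ bs \<and> m \<le> degree as \<and> r \<le> degree bs"
  using assms
proof (induction ps arbitrary: m)
  case Nil
  then show ?case by simp
next
  case (Cons p ps)
  obtain u l where p: "p = (u, l)" by (cases p)
  show ?case
  proof (cases "m = 0")
    case True
    then show ?thesis using Cons.prems by (intro exI[of _ "[]"] exI[of _ "p # ps"]) simp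
  next
    case False
    show ?thesis
    proof (cases "m \<le> l")
      case True
      then show ?thesis using Cons.prems
        by (intro exI[of _ "[p]"] exI[of _ ps]) (auto simp: p)
    next
      case False
      then have "m - l + k + r \<le> degree ps" using Cons.prems by (auto simp: p)
      then obtain as bs where "ps = as @ bs" "m - l \<le> degree as" "r \<le> degree bs"
        using Cons.IH[of "m - l"] Cons.prems(1) by auto
      then show ?thesis by (intro exI[of _ "p # as"] exI[of _ bs]) (auto simp: p)
    qed
  qed
qed

text \<open>
  Conformal weights may be negative, so high filtration degree alone does not give high conformal
  weight; this inclusion does, since \<open>C k\<close> lives in conformal weights \<open>\<ge> 2t + k\<close>.
\<close>

lemma E_subset_C: "\<exists>m. E (int m) \<subseteq> C (Suc k)"
proof (induction k)
  case 0
  have "act ps vac \<in> C (Suc 0)" if "int 1 \<le> int (degree ps)" for ps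
  proof -
    have "degree ps \<noteq> 0" using that by simp
    then have "\<not> (\<forall>p\<in>set ps. snd p = 0)" by (auto simp: degree_def)
    then obtain u l where "(u, l) \<in> set ps" "l \<ge> Suc 0" by (auto simp: Suc_le_eq)
    then show ?thesis by (rule act_in_C)
  qed
  then have "E (int 1) \<subseteq> C (Suc 0)"
    unfolding E_def by (intro span_minimal subspace_C) auto
  then show ?case by blast
next
  case (Suc k)
  then obtain m where m: "E (int m) \<subseteq> C (Suc k)" by blast
  \<comment> \<open>A factor of index above \<open>k + 2\<close> settles the claim at once.
    Otherwise this degree suffices to cut the product into two pieces of degree at least
    \<open>m\<close>: the right piece lies in \<open>C (Suc k)\<close>, and the left one carries it
    into the next subspace.\<close>
  let ?m = "m + Suc (Suc k) + m"
  have "act ps vac \<in> C (Suc (Suc k))" if d: "int ?m \<le> int (degree ps)" for ps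
  proof (cases "\<forall>(u, l)\<in>set ps. l \<le> Suc (Suc k)")
    case True
    then obtain as bs where ps: "ps = as @ bs" and "m \<le> degree as" "m \<le> degree bs"
      using split_by_degree[of ps "Suc (Suc k)" m m] d by auto
    then have "E (int (degree as)) \<subseteq> C (Suc k)" "E (int (degree bs)) \<subseteq> C (Suc k)"
      using E_antimono[of "int m" "int (degree _)"] m by (meson of_nat_mono subset_iff)+
    then show ?thesis
      unfolding ps act_append using act_in_E_degree by (intro act_C_in_C_Suc[of "Suc k"]) auto
  next
    case False
    then obtain u l where "(u, l) \<in> set ps" "l \<ge> Suc (Suc k)" by force
    then show ?thesis by (rule act_in_C)
  qed
  then have "E (int ?m) \<subseteq> C (Suc (Suc k))"
    unfolding E_def[of "int ?m"] by (intro span_minimal subspace_C) auto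
  then show ?case by blast
qed

lemma C2_eq_C: "C2 scale nprod = C 1"
  by (simp add: C2_def C_def)

text \<open>To be used with the homogeneous vectors of \<open>U\<close> as \<open>B\<close>. The
  modes stay fixed, so their strict order survives the expansion.\<close>

lemma act_in_span_generators:
  assumes "fst ` set ps \<subseteq> span B"
  shows "act ps vac \<in> span {act qs vac | qs. fst ` set qs \<subseteq> B \<and> map snd qs = map snd ps}"
  using assms
proof (induction ps)
  case Nil
  then show ?case by (intro span_base CollectI exI[of _ "[]"]) simp
next
  case (Cons p ps)
  obtain u k where p: "p = (u, k)" by (cases p)
  let ?S = "\<lambda>ps. {act qs vac | qs. fst ` set qs \<subseteq> B \<and> map snd qs = map snd ps}"
  have "nprod u (-1 - int k) (act ps vac) \<in> span (?S (p # ps))"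
  proof (rule nprod_left_in[where G = B])
    show "subspace (span (?S (p # ps)))" by simp
    show "u \<in> span B" using Cons.prems by (simp add: p)
    fix b assume b: "b \<in> B"
    show "nprod b (-1 - int k) (act ps vac) \<in> span (?S (p # ps))"
    proof (rule nprod_right_in[where G = "?S ps"])
      show "subspace (span (?S (p # ps)))" by simp
      show "act ps vac \<in> span (?S ps)" using Cons by simp
      fix g assume "g \<in> ?S ps"
      then obtain qs where "g = act qs vac" "fst ` set qs \<subseteq> B" "map snd qs = map snd ps" by blast
      then show "nprod b (-1 - int k) g \<in> span (?S (p # ps))"
        using b by (intro span_base CollectI exI[of _ "(b, k) # qs"]) (simp add: p)
    qed
  qed
  then show ?case by (simp add: p)
qed

end

section \<open>Projections to conformal weights\<close>

context graded_vertex_algebra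
begin

text \<open>The projection onto conformal weight \<open>n\<close>, read off from the inverse of the
  summation bijection.\<close>

definition component :: "int \<Rightarrow> 'v \<Rightarrow> 'v" where
  "component n v = inv_into {f. (\<forall>n. f n \<in> grade n) \<and> finite {n. f n \<noteq> 0}} Sum_any v n"

lemma subspace_grade: "subspace (grade n)"
  using grading by (simp add: is_direct_sum_def)

lemma component_in_grade: "component n v \<in> grade n"
  and finite_component: "finite {n. component n v \<noteq> 0}"
  and Sum_any_component: "Sum_any (\<lambda>n. component n v) = v"
proof -
  let ?F = "{f. (\<forall>n. f n \<in> grade n) \<and> finite {n. f n \<noteq> 0}}"
  have "Sum_any ` ?F = UNIV"
    using grading unfolding is_direct_sum_def bij_betw_def by blast
  then have v: "v \<in> Sum_any ` ?F" by simp
  have "(\<lambda>n. component n v) = inv_into ?F Sum_any v"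
    by (simp add: component_def fun_eq_iff)
  then show "component n v \<in> grade n" "finite {n. component n v \<noteq> 0}"
    "Sum_any (\<lambda>n. component n v) = v"
    using inv_into_into[OF v] f_inv_into_f[OF v] by (auto simp: component_def)
qed

lemma component_Sum_any:
  assumes "\<And>n. f n \<in> grade n" "finite {n. f n \<noteq> 0}"
  shows "component n (Sum_any f) = f n"
proof -
  have "inj_on Sum_any {f. (\<forall>n. f n \<in> grade n) \<and> finite {n. f n \<noteq> 0}}"
    using grading unfolding is_direct_sum_def bij_betw_def by blast
  then show ?thesis
    unfolding component_def using assms by (subst inv_into_f_f) auto
qed

lemma component_grade:
  assumes "v \<in> grade m"
  shows "component n v = (if n = m then v else 0)"
proof -
  let ?f = "\<lambda>n. if n = m then v else 0"
  have "Sum_any ?f = v" by (rule Sum_any.delta[of m "\<lambda>_. v"])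
  moreover have "component n (Sum_any ?f) = ?f n"
    using assms by (intro component_Sum_any) (auto simp: subspace_0 subspace_grade)
  ultimately show ?thesis by simp
qed

lemma component_linear:
  "component n (x + y) = component n x + component n y"
  "component n (scale c x) = scale c (component n x)"
  "component n 0 = 0"
proof -
  let ?S = "\<lambda>x. {n. component n x \<noteq> 0}"
  have "x + y = Sum_any (\<lambda>n. component n x + component n y)"
    by (simp add: Sum_any.distrib finite_component Sum_any_component)
  moreover have "finite {n. component n x + component n y \<noteq> 0}"
    by (rule finite_subset[of _ "?S x \<union> ?S y"]) (auto simp: finite_component)
  ultimately show "component n (x + y) = component n x + component n y"
    using component_Sum_any[of "\<lambda>n. component n x + component n y" n]
    by (simp add: component_in_grade subspace_add subspace_grade)
  have "scale c x = scale c (sum (\<lambda>n. component n x) (?S x))"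
    using Sum_any_component[of x] by (simp add: Sum_any.expand_set)
  also have "\<dots> = sum (\<lambda>n. scale c (component n x)) (?S x)"
    by (rule scale_sum_right)
  also have "\<dots> = Sum_any (\<lambda>n. scale c (component n x))"
    by (rule Sum_any.expand_superset[symmetric]) (auto simp: finite_component)
  finally have "scale c x = Sum_any (\<lambda>n. scale c (component n x))" .
  moreover have "finite {n. scale c (component n x) \<noteq> 0}"
    by (rule finite_subset[of _ "?S x"]) (auto simp: finite_component)
  ultimately show "component n (scale c x) = scale c (component n x)"
    using component_Sum_any[of "\<lambda>n. scale c (component n x)" n]
    by (simp add: component_in_grade subspace_scale subspace_grade)
  show "component n 0 = 0"
    using component_grade[of 0 n n] by (simp add: subspace_0 subspace_grade)
qed

lemma in_span_grade: "v \<in> span (\<Union>n. grade n)"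
proof -
  have "sum (\<lambda>n. component n v) {n. component n v \<noteq> 0} \<in> span (\<Union>n. grade n)"
    by (intro span_sum span_base) (use component_in_grade in blast)
  then show ?thesis
    using Sum_any_component[of v] by (simp add: Sum_any.expand_set)
qed

lemma graded_subspace_subset_span:
  assumes "graded_subspace scale grade U"
  shows "U \<subseteq> span (\<Union>n. U \<inter> grade n)"
proof
  fix u assume u: "u \<in> U"
  have "Sum_any ` {f. (\<forall>n. f n \<in> U \<inter> grade n) \<and> finite {n. f n \<noteq> 0}} = U"
    using assms unfolding graded_subspace_def is_direct_sum_def bij_betw_def by blast
  then obtain f where f: "u = Sum_any f" "\<forall>n. f n \<in> U \<inter> grade n" using u by blast
  have "sum f {n. f n \<noteq> 0} \<in> span (\<Union>n. U \<inter> grade n)"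
    by (intro span_sum span_base) (use f(2) in blast)
  then show "u \<in> span (\<Union>n. U \<inter> grade n)"
    unfolding f(1) by (simp only: Sum_any.expand_set)
qed

lemma act_homogeneous:
  assumes "fst ` set ps \<subseteq> (\<Union>n. grade n)"
  shows "\<exists>n. act ps vac \<in> grade n"
  using assms
proof (induction ps)
  case Nil
  then show ?case using vac_grade by auto
next
  case (Cons p ps)
  obtain u k where p: "p = (u, k)" by (cases p)
  obtain m n where "u \<in> grade m" "act ps vac \<in> grade n" using Cons by (auto simp: p)
  then show ?case unfolding p act_Cons by (blast intro: nprod_grade)
qed

text \<open>Here \<open>U\<close> being graded enters: the monomial expands into monomials in
  homogeneous vectors of \<open>U\<close>, and each of these is homogeneous, hence kept or killed by
  the projection.\<close>

lemma component_monomial_vectors: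
  assumes "graded_subspace scale grade U" "x \<in> monomial_vectors vac nprod U"
  shows "component n x \<in> span (monomial_vectors vac nprod U)"
proof -
  obtain ps where ps: "x = act ps vac" "fst ` set ps \<subseteq> U" "sorted_wrt (>) (map snd ps)"
    using assms(2) unfolding monomial_vectors_act by blast
  have "x \<in> span {act qs vac | qs. fst ` set qs \<subseteq> (\<Union>n. U \<inter> grade n) \<and> map snd qs = map snd ps}"
    unfolding ps(1)
    using ps(2) graded_subspace_subset_span[OF assms(1)] by (intro act_in_span_generators) blast
  then show ?thesis
  proof (rule span_preserving[rotated 2])
    fix g assume "g \<in> {act qs vac | qs. fst ` set qs \<subseteq> (\<Union>n. U \<inter> grade n) \<and> map snd qs = map snd ps}"
    then obtain qs where qs: "g = act qs vac" "fst ` set qs \<subseteq> (\<Union>n. U \<inter> grade n)"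
      "map snd qs = map snd ps" by blast
    have "fst ` set qs \<subseteq> (\<Union>n. grade n)" "fst ` set qs \<subseteq> U" using qs(2) by blast+
    then obtain m where m: "g \<in> grade m" using act_homogeneous qs(1) by blast
    have "g \<in> monomial_vectors vac nprod U"
      unfolding monomial_vectors_act using \<open>fst ` set qs \<subseteq> U\<close> qs ps(3) by auto
    then show "component n g \<in> span (monomial_vectors vac nprod U)"
      by (simp add: component_grade[OF m] span_base span_zero)
  qed (auto simp: component_linear)
qed

lemma component_C:
  assumes t: "\<And>n. n < t \<Longrightarrow> grade n = {0}" and n: "n < 2 * t + int k" and x: "x \<in> C k"
  shows "component n x = 0"
proof -
  have *: "component n (nprod u (-1 - int k) v) = 0" if "u \<in> grade i" "v \<in> grade j" for u v i j
  proof (cases "i < t \<or> j < t")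
    case True
    then have "u = 0 \<or> v = 0" using t that by auto
    then show ?thesis by (auto simp: nprod_zero_left nprod_zero_right component_linear)
  next
    case False
    have "nprod u (-1 - int k) v \<in> grade (j + i - (-1 - int k) - 1)"
      by (rule nprod_grade[OF that])
    moreover have "n \<noteq> j + i - (-1 - int k) - 1" using False n by linarith
    ultimately show ?thesis using component_grade by simp
  qed
  let ?K = "{x. component n x = 0}"
  have K: "subspace ?K" by (simp add: subspace_def component_linear)
  have "nprod u (-1 - int k) v \<in> ?K" for u v
    by (rule nprod_left_in[OF K _ in_span_grade], rule nprod_right_in[OF K _ in_span_grade])
      (use * in blast)
  then have "C k \<subseteq> ?K" unfolding C_def by (intro span_minimal K) blast
  then show ?thesis using x by blast
qed

lemma span_monomial_vectors_eq_UNIV: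
  assumes t: "\<And>n. n < t \<Longrightarrow> grade n = {0}" and U: "graded_subspace scale grade U"
    and C1: "\<And>v. \<exists>u\<in>U. v - u \<in> C 1"
  shows "span (monomial_vectors vac nprod U) = UNIV"
proof -
  let ?S = "span (monomial_vectors vac nprod U)"
  have comp: "component n v \<in> ?S" for n v
  proof -
    \<comment> \<open>Puts \<open>n\<close> below \<open>2t + k + 1\<close>, the lower bound for
      weights in \<open>C (Suc k)\<close>. For \<open>n < 2t\<close> the value 0 of
      \<open>nat\<close> still gives this.\<close>
    define k where "k = nat (n - 2 * t)"
    have k: "n < 2 * t + int (Suc k)" by (simp add: k_def)
    obtain m where m: "E (int m) \<subseteq> C (Suc k)" using E_subset_C by blast
    have "v \<in> span (monomial_vectors vac nprod U \<union> E (int m))"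
      by (rule in_span_monomial_vectors_E[OF C1])
    then show ?thesis
    proof (rule span_preserving[rotated 2])
      fix g assume "g \<in> monomial_vectors vac nprod U \<union> E (int m)"
      then show "component n g \<in> ?S"
        using component_monomial_vectors[OF U] component_C[OF t k] m by (auto simp: span_zero)
    qed (auto simp: component_linear)
  qed
  have "v \<in> ?S" for v
    using Sum_any_in[of ?S "\<lambda>n. component n v"] comp Sum_any_component by simp
  then show ?thesis by blast
qed

end

section \<open>The converse and the equivalence\<close>

text \<open>The empty product is \<open>vac\<close>, which may lie outside \<open>U + C 1\<close>:
  if \<open>V\<close> is spanned by \<open>vac\<close> and \<open>U = 0\<close>, the monomials span
  \<open>V\<close> although \<open>U + C 1 = 0\<close>. Hence the assumption on
  \<open>vac\<close>.\<close>

lemma (in vertex_algebra) monomial_vectors_subset_add_C: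
  assumes "vac \<in> U + C 1" "subspace U"
  shows "monomial_vectors vac nprod U \<subseteq> U + C 1"
proof
  fix x assume "x \<in> monomial_vectors vac nprod U"
  then obtain ps where ps: "x = act ps vac" "fst ` set ps \<subseteq> U" "sorted_wrt (>) (map snd ps)"
    unfolding monomial_vectors_act by blast
  have C: "y \<in> U + C 1" if "y \<in> C 1" for y
    using set_plus_intro[OF subspace_0[OF assms(2)] that] by simp
  show "x \<in> U + C 1"
  proof (cases ps)
    case Nil
    then show ?thesis using ps(1) assms(1) by simp
  next
    case (Cons p qs)
    obtain u k where p: "p = (u, k)" by (cases p)
    show ?thesis
    proof (cases "k = 0")
      case True
      \<comment> \<open>A strictly decreasing list of natural numbers that starts with 0 has length
        one.\<close>
      then have "qs = []" using ps(3) by (cases qs) (auto simp: Cons p)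
      then have "x = u" using ps(1) True by (simp add: Cons p creation)
      then show ?thesis
        using ps(2) set_plus_intro[of u U 0 "C 1"] subspace_0[OF subspace_C] by (simp add: Cons p)
    next
      case False
      then show ?thesis
        unfolding ps(1) by (intro C act_in_C[of u k]) (auto simp: Cons p)
    qed
  qed
qed

theorem theorem4p7:
  fixes scale :: "complex \<Rightarrow> 'v::ab_group_add \<Rightarrow> 'v"
    and vac :: 'v
    and nprod :: "'v \<Rightarrow> int \<Rightarrow> 'v \<Rightarrow> 'v"
    and grade :: "int \<Rightarrow> 'v set"
    and t :: int
    and U :: "'v set"
  assumes "graded_vertex_algebra scale vac nprod grade"
    and "\<And>n. n < t \<Longrightarrow> grade n = {0}"
    and "graded_subspace scale grade U"
  shows "(UNIV = U + C2 scale nprod \<longrightarrow>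
           UNIV = module.span scale (monomial_vectors vac nprod U)) \<and>
         (vac \<in> U + C2 scale nprod \<longrightarrow>
           UNIV = module.span scale (monomial_vectors vac nprod U) \<longrightarrow>
           UNIV = U + C2 scale nprod)"
proof -
  interpret graded_vertex_algebra scale vac nprod grade by fact
  have U: "subspace U" using assms(3) by (simp add: graded_subspace_def)
  have "span (monomial_vectors vac nprod U) = UNIV" if *: "UNIV = U + C 1"
  proof (rule span_monomial_vectors_eq_UNIV[OF assms(2,3)])
    fix v
    obtain u c where "v = u + c" "u \<in> U" "c \<in> C 1" using * by (metis UNIV_I set_plus_elim)
    then show "\<exists>u\<in>U. v - u \<in> C 1" by (intro bexI[of _ u]) simp_all
  qed auto
  moreover have "span (monomial_vectors vac nprod U) \<subseteq> U + C 1" if "vac \<in> U + C 1"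
  proof (rule span_minimal[OF monomial_vectors_subset_add_C[OF that U]])
    have "U + C 1 = {x + y | x y. x \<in> U \<and> y \<in> C 1}" by (auto simp: set_plus_def)
    then show "subspace (U + C 1)" using subspace_sums[OF U subspace_C] by simp
  qed
  ultimately show ?thesis unfolding C2_eq_C by blast
qed

end
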